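(* For every integer $k\geqslant 0$ there exists $n_0$ such that for every integer $n\geqslant n_0$ and every integer $m\in\{0,1,\dots,k\}$, $m$ is an eigenvalue of the adjacency matrix of the Transposition graph $T_n$.
   Context: The Transposition graph $T_n$ is the Cayley graph $\mathrm{Cay}(\mathrm{Sym}_n,T)$ on the symmetric group $\mathrm{Sym}_n$, where $T$ is the set of all $\binom{n}{2}$ transpositions; two permutations $\pi,\sigma$ are adjacent iff $\sigma=\pi\tau$ for some $\tau\in T$. Its spectrum $Spec(T_n)$ is the set of eigenvalues of its adjacency matrix. *)

theory Defs
  imports
    "HOL-Algebra.Sym_Groups"
    "Graph_Theory.Pair_Digraph"
    "Jordan_Normal_Form.Char_Poly"
begin

definition cayley_graph :: "('a, 'b) monoid_scheme \<Rightarrow> 'a set \<Rightarrow> 'a pair_pre_digraph" where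
  "cayley_graph G S =
     \<lparr> pverts = carrier G,
       parcs = {(x, y). x \<in> carrier G \<and> y \<in> carrier G \<and> (\<exists>s\<in>S. y = x \<otimes>\<^bsub>G\<^esub> s)} \<rparr>"

definition transpositions :: "nat \<Rightarrow> (nat \<Rightarrow> nat) set" where
  "transpositions n =
     {Transposition.transpose i j | i j. i \<in> {1..n} \<and> j \<in> {1..n} \<and> i \<noteq> j}"

text \<open>The undirected graph is represented by its symmetric arc relation
  (a transposition is its own inverse).\<close>

definition transposition_graph :: "nat \<Rightarrow> (nat \<Rightarrow> nat) pair_pre_digraph" where
  "transposition_graph n = cayley_graph (sym_group n) (transpositions n)"

text \<open>Matrices are indexed by numbers, so an adjacency matrix is taken with respect to a
  list \<open>vs\<close> enumerating the vertices without repetition.\<close>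

definition vertex_enumeration :: "'a pair_pre_digraph \<Rightarrow> 'a list \<Rightarrow> bool" where
  "vertex_enumeration G vs \<longleftrightarrow> distinct vs \<and> set vs = pverts G"

definition adjacency_matrix :: "'a pair_pre_digraph \<Rightarrow> 'a list \<Rightarrow> real mat" where
  "adjacency_matrix G vs =
     mat (length vs) (length vs) (\<lambda>(i, j). if (vs ! i, vs ! j) \<in> parcs G then 1 else 0)"

lemma vertex_enumeration_transposition_graph_exists:
  "\<exists>vs. vertex_enumeration (transposition_graph n) vs"
proof -
  have "finite (pverts (transposition_graph n))"
    by (simp add: transposition_graph_def cayley_graph_def sym_group_def finite_permutations)
  then show ?thesis
    unfolding vertex_enumeration_def using finite_distinct_list by metis
qed

end

theory Submission
  imports Defs
begin

text \<open>
  Fill a Young diagram of size \<open>n\<close> with \<open>1, \<dots>, n\<close>, let \<open>R\<close> and \<open>C\<close> be the row and column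
  stabilisers, and let \<open>a = \<Sum>p\<in>R. p\<close>, \<open>b = \<Sum>q\<in>C. sgn q \<cdot> q\<close> in the group algebra. The sum \<open>z\<close> of all
  transpositions is central, so \<open>a b z = a z b\<close> is the sum of all \<open>a \<tau> b\<close>. This term is \<open>a b\<close> if
  \<open>\<tau>\<close> swaps two entries of a row, \<open>- a b\<close> if it swaps two entries of a column, and \<open>0\<close> otherwise:
  in the last case some transpositions \<open>t \<in> R\<close>, \<open>s \<in> C\<close> satisfy \<open>t \<tau> = \<tau> s\<close>, hence
  \<open>a \<tau> b = a t \<tau> b = a \<tau> s b = - a \<tau> b\<close>. Thus \<open>a b \<noteq> 0\<close> is an eigenvector whose eigenvalue is the
  sum of the contents \<open>column - row\<close> of the boxes.

  The hook with arm \<open>m\<close> and leg \<open>m - 1\<close> has content sum \<open>m\<close>. Wrapping a diagram in a symmetric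
  hook with arm and leg \<open>c\<close> keeps the content sum and adds \<open>2 c + 1\<close> boxes; one or two
  such hooks, according to parity, reach every large \<open>n\<close>.
\<close>

section \<open>Transpositions in the symmetric group\<close>

lemma finite_transpositions: "finite (transpositions n)"
proof -
  have "transpositions n \<subseteq> (\<lambda>(i, j). transpose i j) ` ({1..n} \<times> {1..n})"
    by (auto simp: transpositions_def)
  then show ?thesis by (rule finite_subset) auto
qed

lemma conjugate_transposition:
  assumes "q permutes {1..n}" "\<tau> \<in> transpositions n"
  shows "q \<circ> \<tau> \<circ> inv' q \<in> transpositions n"
proof -
  obtain i j where ij: "\<tau> = transpose i j" "i \<in> {1..n}" "j \<in> {1..n}" "i \<noteq> j"
    using assms(2) by (auto simp: transpositions_def)
  have "q \<circ> \<tau> \<circ> inv' q = transpose (q i) (q j)"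
    unfolding ij fun_eq_iff transpose_def
    using permutes_inverses[OF assms(1)] by (auto simp: fun_eq_iff)
  moreover have "q i \<in> {1..n}" "q j \<in> {1..n}" "q i \<noteq> q j"
    using ij permutes_in_image[OF assms(1)] permutes_inj[OF assms(1)] by (auto dest: injD)
  ultimately show ?thesis unfolding transpositions_def by blast
qed

section \<open>Fillings of Young diagrams and the Young symmetrizer\<close>

locale young_filling =
  fixes n :: nat and row col :: "nat \<Rightarrow> nat"
  assumes inj: "\<And>i j. \<lbrakk>i \<in> {1..n}; j \<in> {1..n}; row i = row j; col i = col j\<rbrakk> \<Longrightarrow> i = j"
    and down_closed: "\<And>j r c. \<lbrakk>j \<in> {1..n}; r \<le> row j; c \<le> col j\<rbrakk>
          \<Longrightarrow> \<exists>k\<in>{1..n}. row k = r \<and> col k = c"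
begin

definition row_group :: "(nat \<Rightarrow> nat) set" where
  "row_group = {p. p permutes {1..n} \<and> (\<forall>x. row (p x) = row x)}"

definition col_group :: "(nat \<Rightarrow> nat) set" where
  "col_group = {p. p permutes {1..n} \<and> (\<forall>x. col (p x) = col x)}"

text \<open>The coefficient of \<open>\<pi>\<close> in \<open>a \<tau>\<inverse> b\<close>.\<close>

definition twisted_sum :: "(nat \<Rightarrow> nat) \<Rightarrow> (nat \<Rightarrow> nat) \<Rightarrow> real" where
  "twisted_sum \<pi> \<tau> = (\<Sum>q\<in>col_group. of_int (sign q) * of_bool (\<pi> \<circ> q \<circ> \<tau> \<in> row_group))"

text \<open>The Young symmetrizer \<open>a b\<close> as a function: \<pi> is an element of
  \<open>row_group\<close> times the inverse of q, and that inverse has the sign of q.\<close>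

definition symmetrizer :: "(nat \<Rightarrow> nat) \<Rightarrow> real" where
  "symmetrizer \<pi> = twisted_sum \<pi> id"

text \<open>Conjugating the diagram turns column transpositions into row transpositions, so that one
  count serves both.\<close>

lemma transpose_flip: "young_filling n col row"
  by unfold_locales (use inj down_closed in blast)+

lemma finite_col_group: "finite col_group"
  unfolding col_group_def
  by (rule finite_subset[OF _ finite_permutations[of "{1..n}"]]) auto

lemma transpose_in_row_group:
  "\<lbrakk>i \<in> {1..n}; j \<in> {1..n}; row i = row j\<rbrakk> \<Longrightarrow> transpose i j \<in> row_group"
  by (auto simp: row_group_def permutes_swap_id transpose_def)

lemma transpose_in_col_group:
  "\<lbrakk>i \<in> {1..n}; j \<in> {1..n}; col i = col j\<rbrakk> \<Longrightarrow> transpose i j \<in> col_group"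
  by (auto simp: col_group_def permutes_swap_id transpose_def)

lemma row_group_comp: "\<lbrakk>p \<in> row_group; q \<in> row_group\<rbrakk> \<Longrightarrow> p \<circ> q \<in> row_group"
  by (auto simp: row_group_def intro: permutes_compose)

lemma col_group_comp: "\<lbrakk>p \<in> col_group; q \<in> col_group\<rbrakk> \<Longrightarrow> p \<circ> q \<in> col_group"
  by (auto simp: col_group_def intro: permutes_compose)

lemma row_group_int_col_group: "row_group \<inter> col_group = {id}"
proof
  show "{id} \<subseteq> row_group \<inter> col_group"
    by (auto simp: row_group_def col_group_def permutes_id)
  show "row_group \<inter> col_group \<subseteq> {id}"
  proof
    fix p assume p: "p \<in> row_group \<inter> col_group"
    then have perm: "p permutes {1..n}" by (simp add: row_group_def)
    have "p x = x" for x
    proof (cases "x \<in> {1..n}")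
      case True
      then have "p x \<in> {1..n}" using permutes_in_image[OF perm] by blast
      then show ?thesis using p True inj[of "p x" x] by (simp add: row_group_def col_group_def)
    next
      case False
      then show ?thesis using permutes_not_in[OF perm] by blast
    qed
    then show "p \<in> {id}" by auto
  qed
qed

text \<open>Only q = id contributes. This makes the later eigenvector nonzero.\<close>

lemma symmetrizer_id: "symmetrizer id = 1"
proof -
  have "symmetrizer id = (\<Sum>q\<in>col_group. if q = id then 1 else 0)"
    unfolding symmetrizer_def twisted_sum_def
    using row_group_int_col_group by (intro sum.cong) (auto simp: sign_id)
  also have "\<dots> = 1"
    using row_group_int_col_group finite_col_group by (auto simp: sum.delta)
  finally show ?thesis .
qed

text \<open>Inverting the composition puts the row transposition next to \<open>a\<close>, which
  absorbs it.\<close>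

lemma twisted_sum_row:
  assumes "i \<in> {1..n}" "j \<in> {1..n}" "row i = row j"
  shows "twisted_sum \<pi> (\<tau> \<circ> transpose i j) = twisted_sum \<pi> \<tau>"
proof -
  have t: "transpose i j \<in> row_group" by (rule transpose_in_row_group[OF assms])
  have "p \<circ> transpose i j \<in> row_group \<longleftrightarrow> p \<in> row_group" for p
    using row_group_comp[OF _ t, of p] row_group_comp[OF _ t, of "p \<circ> transpose i j"]
    by (auto simp: comp_assoc)
  then show ?thesis unfolding twisted_sum_def by (simp flip: comp_assoc)
qed

text \<open>Here the inverse has the column transposition next to \<open>b\<close>; substituting
  \<open>q \<circ> ?s\<close> for q flips the sign.\<close>

lemma twisted_sum_col:
  assumes "i \<in> {1..n}" "j \<in> {1..n}" "col i = col j" "i \<noteq> j"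
  shows "twisted_sum \<pi> (transpose i j \<circ> \<tau>) = - twisted_sum \<pi> \<tau>"
proof -
  let ?s = "transpose i j"
  have s: "?s \<in> col_group" by (rule transpose_in_col_group[OF assms(1-3)])
  have sgn: "sign (q \<circ> ?s) = - sign q" if "q \<in> col_group" for q
  proof -
    have "permutation q"
      using that by (auto simp: col_group_def permutation_permutes)
    then show ?thesis using assms(4) by (simp add: sign_compose permutation_swap_id sign_swap_id)
  qed
  have "twisted_sum \<pi> \<tau> = (\<Sum>q\<in>col_group. of_int (sign (q \<circ> ?s)) * of_bool (\<pi> \<circ> (q \<circ> ?s) \<circ> \<tau> \<in> row_group))"
    unfolding twisted_sum_def
    by (rule sum.reindex_bij_witness[of _ "\<lambda>q. q \<circ> ?s" "\<lambda>q. q \<circ> ?s"])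
      (auto simp: comp_assoc col_group_comp[OF _ s])
  also have "\<dots> = - twisted_sum \<pi> (?s \<circ> \<tau>)"
    unfolding twisted_sum_def sum_negf[symmetric]
    by (intro sum.cong) (auto simp: sgn comp_assoc)
  finally show ?thesis by simp
qed

lemma twisted_sum_neither:
  assumes "i \<in> {1..n}" "j \<in> {1..n}" "row i \<noteq> row j" "col i \<noteq> col j"
  shows "twisted_sum \<pi> (transpose i j) = 0"
proof -
  have *: "twisted_sum \<pi> (transpose i j) = 0"
    if ij: "i \<in> {1..n}" "j \<in> {1..n}" "row i < row j" "col i \<noteq> col j" for i j
  proof -
    \<comment> \<open>The box in the row of i and the column of j belongs to the diagram because it
      lies above the box of j.\<close>
    obtain k where k: "k \<in> {1..n}" "row k = row i" "col k = col j"
      using down_closed[of j "row i" "col j"] ij by auto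
    have ne: "i \<noteq> j" "k \<noteq> i" "k \<noteq> j" using ij k by auto
    \<comment> \<open>Both sides are the same 3-cycle. Swapping j and k is a column swap, swapping i
      and k a row swap, so the value equals its own negative.\<close>
    have "transpose j k \<circ> transpose i j = transpose i j \<circ> transpose i k"
      using ne by (auto simp: fun_eq_iff transpose_def)
    then have "- twisted_sum \<pi> (transpose i j) = twisted_sum \<pi> (transpose i j)"
      using twisted_sum_col[of j k \<pi> "transpose i j"] twisted_sum_row[of i k \<pi> "transpose i j"]
        ij k ne by simp
    then show ?thesis by simp
  qed
  show ?thesis
    using *[of i j] *[of j i] assms by (cases "row i < row j") (auto simp: transpose_commute)
qed

text \<open>Centrality of the sum of all transpositions: \<pi> \<tau> q = \<pi> q (q' \<tau> q) with
  q' the inverse of q, and conjugation permutes the transpositions.\<close>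

lemma sum_symmetrizer_eq_sum_twisted_sum:
  "(\<Sum>\<tau>\<in>transpositions n. symmetrizer (\<pi> \<circ> \<tau>)) = (\<Sum>\<tau>\<in>transpositions n. twisted_sum \<pi> \<tau>)"
proof -
  have "(\<Sum>\<tau>\<in>transpositions n. of_int (sign q) * of_bool (\<pi> \<circ> \<tau> \<circ> q \<in> row_group))
      = (\<Sum>\<tau>\<in>transpositions n. of_int (sign q) * of_bool (\<pi> \<circ> q \<circ> \<tau> \<in> row_group) :: real)"
    if "q \<in> col_group" for q
  proof -
    have q: "q permutes {1..n}" using that by (simp add: col_group_def)
    have iq: "inv' q permutes {1..n}" by (rule permutes_inv[OF q])
    have inv: "q \<circ> inv' q = id" "inv' q \<circ> q = id" "inv' (inv' q) = q"
      using permutes_inv_o[OF q] permutes_inv_inv[OF q] by auto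
    have cancel: "q \<circ> (inv' q \<circ> h) = h" "inv' q \<circ> (q \<circ> h) = h" for h :: "nat \<Rightarrow> nat"
      using inv by (auto simp flip: comp_assoc)
    show ?thesis
      by (rule sum.reindex_bij_witness[of _ "\<lambda>\<tau>. q \<circ> \<tau> \<circ> inv' q" "\<lambda>\<tau>. inv' q \<circ> \<tau> \<circ> q"])
        (use conjugate_transposition[OF q] conjugate_transposition[OF iq] in
          \<open>auto simp: comp_assoc inv cancel\<close>)
  qed
  then show ?thesis
    unfolding symmetrizer_def twisted_sum_def comp_id
    by (subst (1 2) sum.swap) (rule sum.cong, auto)
qed

section \<open>Counting row transpositions, and the content sum as eigenvalue\<close>

definition row_transpositions :: "(nat \<Rightarrow> nat) set" where
  "row_transpositions = {transpose i j | i j. i \<in> {1..n} \<and> j \<in> {1..n} \<and> i \<noteq> j \<and> row i = row j}"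

text \<open>Each transposition is counted at the entry j further right: columns are numbered from 0
  and rows have no gaps, so \<open>col j\<close> entries precede j.\<close>

lemma card_row_transpositions: "card row_transpositions = (\<Sum>j = 1..n. col j)"
proof -
  let ?left = "\<lambda>j. {i \<in> {1..n}. row i = row j \<and> col i < col j}"
  have left: "card (?left j) = col j" if j: "j \<in> {1..n}" for j
  proof -
    have "bij_betw col (?left j) {..<col j}"
      unfolding bij_betw_def
    proof
      show "inj_on col (?left j)" using inj by (auto simp: inj_on_def)
      show "col ` ?left j = {..<col j}"
      proof (intro equalityI subsetI)
        fix c assume "c \<in> {..<col j}"
        then show "c \<in> col ` ?left j" using down_closed[OF j order_refl, of c] by force
      qed auto
    qed
    then show ?thesis by (simp add: bij_betw_same_card)
  qed
  let ?P = "SIGMA j:{1..n}. ?left j"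
  have "inj_on (\<lambda>(j, i). transpose i j) ?P"
  proof (rule inj_onI, clarify)
    fix j i j' i'
    assume lt: "col i < col j" "col i' < col j'" and eq: "transpose i j = transpose i' j'"
    have "transpose i' j' i = j" using fun_cong[OF eq, of i] by simp
    moreover have "i \<noteq> j" using lt by auto
    ultimately have "i = i' \<and> j = j' \<or> i = j' \<and> j = i'"
      by (auto simp: transpose_def split: if_splits)
    then show "j = j' \<and> i = i'" using lt by auto
  qed
  moreover have "row_transpositions = (\<lambda>(j, i). transpose i j) ` ?P"
  proof (intro equalityI subsetI)
    fix \<tau> assume "\<tau> \<in> row_transpositions"
    then obtain i j where ij: "\<tau> = transpose i j" "i \<in> {1..n}" "j \<in> {1..n}" "i \<noteq> j" "row i = row j"
      by (auto simp: row_transpositions_def)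
    then have "col i < col j \<or> col j < col i" using inj[of i j] by (meson linorder_neqE_nat)
    then have "(j, i) \<in> ?P \<or> (i, j) \<in> ?P" using ij by auto
    moreover have "\<tau> = (\<lambda>(j, i). transpose i j) (j, i)" "\<tau> = (\<lambda>(j, i). transpose i j) (i, j)"
      using ij(1) by (simp_all add: transpose_commute)
    ultimately show "\<tau> \<in> (\<lambda>(j, i). transpose i j) ` ?P" by blast
  next
    fix \<tau> assume "\<tau> \<in> (\<lambda>(j, i). transpose i j) ` ?P"
    then obtain i j where "\<tau> = transpose i j" "i \<in> {1..n}" "j \<in> {1..n}" "row i = row j" "col i < col j"
      by auto
    moreover from this have "i \<noteq> j" by auto
    ultimately show "\<tau> \<in> row_transpositions" unfolding row_transpositions_def by blast
  qed
  ultimately have "card row_transpositions = card ?P" by (simp add: card_image)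
  also have "\<dots> = (\<Sum>j = 1..n. card (?left j))" by (intro card_SigmaI) auto
  also have "\<dots> = (\<Sum>j = 1..n. col j)" by (rule sum.cong[OF refl left])
  finally show ?thesis .
qed

definition content_sum :: int where
  "content_sum = (\<Sum>j = 1..n. int (col j) - int (row j))"

lemma sum_symmetrizer:
  "(\<Sum>\<tau>\<in>transpositions n. symmetrizer (\<pi> \<circ> \<tau>)) = of_int content_sum * symmetrizer \<pi>"
proof -
  interpret flip: young_filling n col row by (rule transpose_flip)
  let ?A = "row_transpositions" and ?B = "flip.row_transpositions"
  have sub: "?A \<subseteq> transpositions n" "?B \<subseteq> transpositions n"
    by (auto simp: row_transpositions_def flip.row_transpositions_def transpositions_def)
  then have fin: "finite ?A" "finite ?B" using finite_subset[OF _ finite_transpositions] by auto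
  have A: "twisted_sum \<pi> \<tau> = symmetrizer \<pi>" if "\<tau> \<in> ?A" for \<tau>
    using that twisted_sum_row[of _ _ \<pi> id]
    by (auto simp: row_transpositions_def symmetrizer_def)
  have B: "twisted_sum \<pi> \<tau> = - symmetrizer \<pi>" if "\<tau> \<in> ?B" for \<tau>
    using that twisted_sum_col[of _ _ \<pi> id]
    by (auto simp: flip.row_transpositions_def symmetrizer_def)
  \<comment> \<open>A transposition determines the pair it moves, and distinct entries never share
    both row and column.\<close>
  have disj: "?A \<inter> ?B = {}"
  proof (rule ccontr)
    assume "?A \<inter> ?B \<noteq> {}"
    then obtain i j \<tau> where ij: "\<tau> = transpose i j" "i \<in> {1..n}" "j \<in> {1..n}" "i \<noteq> j" "row i = row j"
      and "\<tau> \<in> ?B" by (auto simp: row_transpositions_def)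
    then obtain i' j' where ij': "\<tau> = transpose i' j'" "col i' = col j'"
      by (auto simp: flip.row_transpositions_def)
    have "transpose i' j' i = j" using ij(1) ij'(1) by (metis transpose_apply_first)
    then have "col i = col j" using ij(4) ij'(2) by (auto simp: transpose_def split: if_splits)
    then show False using inj[of i j] ij by blast
  qed
  have "(\<Sum>\<tau>\<in>transpositions n. twisted_sum \<pi> \<tau>) = (\<Sum>\<tau>\<in>?A \<union> ?B. twisted_sum \<pi> \<tau>)"
  proof (rule sum.mono_neutral_right[OF finite_transpositions])
    show "?A \<union> ?B \<subseteq> transpositions n" using sub by blast
    show "\<forall>\<tau>\<in>transpositions n - (?A \<union> ?B). twisted_sum \<pi> \<tau> = 0"
    proof
      fix \<tau> assume t: "\<tau> \<in> transpositions n - (?A \<union> ?B)"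
      then obtain i j where ij: "\<tau> = transpose i j" "i \<in> {1..n}" "j \<in> {1..n}" "i \<noteq> j"
        by (auto simp: transpositions_def)
      then have "row i \<noteq> row j" "col i \<noteq> col j"
        using t unfolding row_transpositions_def flip.row_transpositions_def by blast+
      then show "twisted_sum \<pi> \<tau> = 0" using twisted_sum_neither ij by simp
    qed
  qed
  also have "\<dots> = (real (card ?A) - real (card ?B)) * symmetrizer \<pi>"
    by (subst sum.union_disjoint[OF fin disj]) (simp add: A B algebra_simps)
  also have "real (card ?A) - real (card ?B) = of_int content_sum"
    by (simp add: card_row_transpositions flip.card_row_transpositions content_sum_def sum_subtractf)
  finally show ?thesis by (simp add: sum_symmetrizer_eq_sum_twisted_sum)
qed

text \<open>The eigenvector lists the values of \<open>symmetrizer\<close>; the matrix sums them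
  over the neighbours x \<circ> \<tau> of each vertex x.\<close>

lemma eigenvalue_content_sum:
  assumes "vertex_enumeration (transposition_graph n) vs"
  shows "eigenvalue (adjacency_matrix (transposition_graph n) vs) (of_int content_sum)"
proof -
  let ?G = "transposition_graph n" and ?N = "length vs"
  let ?M = "adjacency_matrix ?G vs"
  let ?v = "vec ?N (\<lambda>i. symmetrizer (vs ! i))"
  have vs: "distinct vs" "set vs = {p. p permutes {1..n}}"
    using assms by (auto simp: vertex_enumeration_def transposition_graph_def cayley_graph_def sym_group_def)
  have arcs: "(x, y) \<in> parcs ?G \<longleftrightarrow> y \<in> (\<lambda>\<tau>. x \<circ> \<tau>) ` transpositions n"
    if "x \<in> set vs" "y \<in> set vs" for x y
    using that vs by (auto simp: transposition_graph_def cayley_graph_def sym_group_def)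
  have row: "(\<Sum>j<?N. (if (x, vs ! j) \<in> parcs ?G then 1 else 0) * symmetrizer (vs ! j))
      = of_int content_sum * symmetrizer x" if x: "x \<in> set vs" for x
  proof -
    have px: "x permutes {1..n}" using x vs by simp
    have img: "(\<lambda>\<tau>. x \<circ> \<tau>) ` transpositions n \<subseteq> set vs"
      using px vs by (auto simp: transpositions_def intro!: permutes_compose permutes_swap_id)
    have inj: "inj_on (\<lambda>\<tau>. x \<circ> \<tau>) (transpositions n)"
      using fun.inj_map[OF permutes_inj[OF px]] by (rule inj_on_subset) simp
    have "(\<Sum>j<?N. (if (x, vs ! j) \<in> parcs ?G then 1 else 0) * symmetrizer (vs ! j))
        = (\<Sum>y\<in>set vs. (if (x, y) \<in> parcs ?G then 1 else 0) * symmetrizer y)"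
      using bij_betw_nth[OF vs(1) refl refl]
      by (rule sum.reindex_bij_betw)
    also have "\<dots> = (\<Sum>y\<in>(\<lambda>\<tau>. x \<circ> \<tau>) ` transpositions n. symmetrizer y)"
      using img arcs[OF x] by (intro sum.mono_neutral_cong_right) auto
    also have "\<dots> = (\<Sum>\<tau>\<in>transpositions n. symmetrizer (x \<circ> \<tau>))"
      by (simp add: sum.reindex[OF inj])
    finally show ?thesis by (simp add: sum_symmetrizer)
  qed
  have "?M *\<^sub>v ?v = of_int content_sum \<cdot>\<^sub>v ?v"
    by (rule eq_vecI) (simp_all add: adjacency_matrix_def scalar_prod_def row atLeast0LessThan)
  moreover have "?v \<noteq> 0\<^sub>v ?N"
  proof
    assume v0: "?v = 0\<^sub>v ?N"
    have "id \<in> set vs" using vs permutes_id by blast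
    then obtain i where i: "i < ?N" "vs ! i = id" by (auto simp: in_set_conv_nth)
    have "?v $ i = 0" using v0 i by simp
    then show False using i symmetrizer_id by simp
  qed
  ultimately have "eigenvector ?M ?v (of_int content_sum)"
    by (simp add: eigenvector_def adjacency_matrix_def)
  then show ?thesis by (auto simp: eigenvalue_def)
qed

end

section \<open>Young diagrams as sets of boxes\<close>

definition young_diagram :: "(nat \<times> nat) set \<Rightarrow> bool" where
  "young_diagram B \<longleftrightarrow> finite B \<and> (\<forall>r c r' c'. (r, c) \<in> B \<longrightarrow> r' \<le> r \<longrightarrow> c' \<le> c \<longrightarrow> (r', c') \<in> B)"

definition diagram_content :: "(nat \<times> nat) set \<Rightarrow> int" where
  "diagram_content B = (\<Sum>(r, c)\<in>B. int c - int r)"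

text \<open>Any bijection from {1..n} onto the boxes is a suitable filling, and the content sum does
  not depend on its choice.\<close>

lemma eigenvalue_diagram_content:
  assumes B: "young_diagram B" "card B = n" and vs: "vertex_enumeration (transposition_graph n) vs"
  shows "eigenvalue (adjacency_matrix (transposition_graph n) vs) (of_int (diagram_content B))"
proof -
  have "finite B" using B by (simp add: young_diagram_def)
  then obtain \<beta> where \<beta>: "bij_betw \<beta> {1..n} B"
    using B(2) finite_same_card_bij[of "{1..n}" B] by auto
  interpret young_filling n "fst \<circ> \<beta>" "snd \<circ> \<beta>"
  proof
    fix i j assume "i \<in> {1..n}" "j \<in> {1..n}" "(fst \<circ> \<beta>) i = (fst \<circ> \<beta>) j" "(snd \<circ> \<beta>) i = (snd \<circ> \<beta>) j"
    then show "i = j" by (intro inj_onD[OF bij_betw_imp_inj_on[OF \<beta>]]) (simp_all add: prod_eq_iff)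
  next
    fix j r c assume j: "j \<in> {1..n}" "r \<le> (fst \<circ> \<beta>) j" "c \<le> (snd \<circ> \<beta>) j"
    have "\<beta> j \<in> B" using bij_betwE[OF \<beta>] j(1) by blast
    then have "(r, c) \<in> B"
      using B(1) j unfolding young_diagram_def by (metis comp_apply prod.collapse)
    then show "\<exists>k\<in>{1..n}. (fst \<circ> \<beta>) k = r \<and> (snd \<circ> \<beta>) k = c"
      using bij_betw_imp_surj_on[OF \<beta>] by (metis comp_apply fst_conv imageE snd_conv)
  qed
  have "content_sum = diagram_content B"
    unfolding content_sum_def diagram_content_def
    using sum.reindex_bij_betw[OF \<beta>, of "\<lambda>(r, c). int c - int r"]
    by (simp add: case_prod_unfold)
  then show ?thesis using eigenvalue_content_sum[OF vs] by simp
qed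

section \<open>Hooks, and diagrams wrapped in symmetric hooks\<close>

definition hook :: "nat \<Rightarrow> nat \<Rightarrow> (nat \<times> nat) set" where
  "hook a b = {0} \<times> {..a} \<union> {1..b} \<times> {0}"

lemma finite_hook [simp]: "finite (hook a b)"
  by (simp add: hook_def)

lemma card_hook: "card (hook a b) = a + b + 1"
  unfolding hook_def by (subst card_Un_disjoint) (auto simp: card_cartesian_product)

text \<open>The arm has contents 1, ..., a and the leg -1, ..., -b; the corner has content 0, so
  both sums may start at 0.\<close>

lemma diagram_content_hook: "diagram_content (hook a b) = int (\<Sum>{..a}) - int (\<Sum>{..b})"
proof -
  have "diagram_content (hook a b) = (\<Sum>c\<le>a. int c) + (\<Sum>r = 1..b. - int r)"
    unfolding diagram_content_def hook_def
    by (subst sum.union_disjoint) (auto simp: sum.cartesian_product[symmetric])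
  also have "(\<Sum>r = 1..b. - int r) = - (\<Sum>r\<le>b. int r)"
    by (simp add: sum_negf atMost_atLeast0 sum.atLeast_Suc_atMost)
  finally show ?thesis by simp
qed

lemma young_diagram_hook: "young_diagram (hook a b)"
  by (auto simp: young_diagram_def hook_def)

text \<open>The diagonal shift keeps every content and frees the first row and column for the
  hook.\<close>

definition wrap :: "nat \<Rightarrow> (nat \<times> nat) set \<Rightarrow> (nat \<times> nat) set" where
  "wrap c B = hook c c \<union> map_prod Suc Suc ` B"

text \<open>Arm and leg of the hook cancel in the content sum. As B fits in a square of side c, the
  hook extends at least as far as the shifted B.\<close>

lemma
  assumes B: "young_diagram B" "B \<subseteq> {..<c} \<times> {..<c}"
  shows young_diagram_wrap: "young_diagram (wrap c B)"
    and card_wrap: "card (wrap c B) = card B + 2 * c + 1"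
    and diagram_content_wrap: "diagram_content (wrap c B) = diagram_content B"
    and wrap_subset: "wrap c B \<subseteq> {..<Suc c} \<times> {..<Suc c}"
proof -
  have fin: "finite B" using B by (simp add: young_diagram_def)
  have disj: "hook c c \<inter> map_prod Suc Suc ` B = {}" by (auto simp: hook_def)
  have inj: "inj_on (map_prod Suc Suc) B" by (auto intro!: inj_onI)
  show "wrap c B \<subseteq> {..<Suc c} \<times> {..<Suc c}" using B(2) by (auto simp: wrap_def hook_def)
  show "card (wrap c B) = card B + 2 * c + 1"
    unfolding wrap_def by (subst card_Un_disjoint[OF _ _ disj]) (use fin inj in \<open>auto simp: card_hook card_image\<close>)
  show "diagram_content (wrap c B) = diagram_content B"
    using diagram_content_hook[of c c] fin unfolding wrap_def diagram_content_def
    by (subst sum.union_disjoint[OF _ _ disj]) (auto simp: sum.reindex[OF inj] case_prod_unfold)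
  show "young_diagram (wrap c B)"
    unfolding young_diagram_def
  proof (intro conjI allI impI)
    show "finite (wrap c B)" using fin by (simp add: wrap_def)
    fix r k r' k' assume rk: "(r, k) \<in> wrap c B" "r' \<le> r" "k' \<le> k"
    then have "r \<le> c" "k \<le> c" using B(2) by (auto simp: wrap_def hook_def)
    \<comment> \<open>Border boxes lie in the hook; an inner box is shifted back into B.\<close>
    then show "(r', k') \<in> wrap c B"
    proof (cases "r' = 0 \<or> k' = 0")
      case True
      then show ?thesis using rk \<open>r \<le> c\<close> \<open>k \<le> c\<close> by (auto simp: wrap_def hook_def)
    next
      case False
      then obtain a b where ab: "r' = Suc a" "k' = Suc b" by (metis not0_implies_Suc)
      then have "(r - 1, k - 1) \<in> B" using rk by (auto simp: wrap_def hook_def)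
      moreover have "a \<le> r - 1" "b \<le> k - 1" using rk ab by auto
      ultimately have "(a, b) \<in> B" using B(1) unfolding young_diagram_def by blast
      then show ?thesis using ab by (force simp: wrap_def)
    qed
  qed
qed

text \<open>A hook adds the odd number 2 c + 1 of boxes with c free, so one hook reaches the large n
  of one parity and a second hook those of the other.\<close>

lemma exists_diagram_with_content:
  "\<exists>n\<^sub>0. \<forall>n\<ge>n\<^sub>0. \<exists>B. young_diagram B \<and> card B = n \<and> diagram_content B = int m"
proof -
  \<comment> \<open>For \<open>m = 0\<close> the truncated leg length gives a single box, which has content \<open>0\<close> as needed.\<close>
  define A where "A = hook m (m - 1)"
  \<comment> \<open>The arm m + 1 is the side of a square containing \<open>A\<close>; the 2 m + 3
    added boxes change the parity.\<close>
  define A' where "A' = wrap (Suc m) A"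
  have A: "young_diagram A" "diagram_content A = int m" "A \<subseteq> {..<Suc m} \<times> {..<Suc m}"
  proof -
    show "young_diagram A" by (simp add: A_def young_diagram_hook)
    show "diagram_content A = int m"
      by (cases m) (simp_all add: A_def diagram_content_hook)
    show "A \<subseteq> {..<Suc m} \<times> {..<Suc m}" by (auto simp: A_def hook_def)
  qed
  have A': "young_diagram A'" "diagram_content A' = int m" "A' \<subseteq> {..<m + 2} \<times> {..<m + 2}"
      "card A' = card A + 2 * m + 3"
    using young_diagram_wrap[OF A(1,3)] diagram_content_wrap[OF A(1,3)] wrap_subset[OF A(1,3)]
      card_wrap[OF A(1,3)] A(2) by (simp_all add: A'_def)
  have step: "\<exists>B. young_diagram B \<and> card B = n \<and> diagram_content B = int m"
    if D: "young_diagram D" "diagram_content D = int m" "D \<subseteq> {..<m + 2} \<times> {..<m + 2}"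
      and n: "n = card D + 2 * c + 1" "m + 2 \<le> c" for D n c
  proof -
    have sub: "D \<subseteq> {..<c} \<times> {..<c}" using D(3) n(2) by force
    show ?thesis
      using young_diagram_wrap[OF D(1) sub] diagram_content_wrap[OF D(1) sub] card_wrap[OF D(1) sub]
        D(2) n(1) by auto
  qed
  \<comment> \<open>The bound is what the even case asks for: c \<ge> 2 m + 4, so that the outer arm
    c - (m + 2) is at least m + 2.\<close>
  have "\<exists>B. young_diagram B \<and> card B = n \<and> diagram_content B = int m"
    if n: "n \<ge> card A + 4 * m + 8" for n
  proof (cases "odd (n - card A)")
    case True
    then obtain c where "n - card A = 2 * c + 1" by (rule oddE)
    then show ?thesis using n A by (intro step[of A n c]) auto
  next
    case False
    then obtain c where "n - card A = 2 * c" using evenE by blast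
    \<comment> \<open>The 2 m + 3 boxes of the inner hook and the 2 (c - (m + 2)) + 1 of the outer
      one add up to 2 c.\<close>
    then show ?thesis using n A' by (intro step[of A' n "c - (m + 2)"]) auto
  qed
  then show ?thesis by blast
qed

theorem theorem2:
  shows "\<forall>k::nat. \<exists>n\<^sub>0::nat. \<forall>n\<ge>n\<^sub>0. \<forall>m\<in>{0..k}. \<forall>vs.
           vertex_enumeration (transposition_graph n) vs \<longrightarrow>
           eigenvalue (adjacency_matrix (transposition_graph n) vs) (real m)"
proof
  fix k :: nat
  obtain N where N: "\<And>m n. n \<ge> N m \<Longrightarrow> \<exists>B. young_diagram B \<and> card B = n \<and> diagram_content B = int m"
    using exists_diagram_with_content by metis
  show "\<exists>n\<^sub>0::nat. \<forall>n\<ge>n\<^sub>0. \<forall>m\<in>{0..k}. \<forall>vs.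
           vertex_enumeration (transposition_graph n) vs \<longrightarrow>
           eigenvalue (adjacency_matrix (transposition_graph n) vs) (real m)"
  proof (intro exI allI ballI impI)
    fix n m vs
    assume n: "n \<ge> Max (N ` {0..k})" and m: "m \<in> {0..k}"
      and vs: "vertex_enumeration (transposition_graph n) vs"
    \<comment> \<open>The maximum of the finitely many thresholds serves all m up to k at
      once.\<close>
    have "N m \<le> n" using n m by (meson Max_ge finite_atLeastAtMost finite_imageI image_eqI order_trans)
    then obtain B where "young_diagram B" "card B = n" "diagram_content B = int m"
      using N by blast
    then show "eigenvalue (adjacency_matrix (transposition_graph n) vs) (real m)"
      using eigenvalue_diagram_content[OF _ _ vs] by fastforce
  qed
qed

end
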